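(* Assume that ZFC is consistent. Then for all $n\ge1$, each of the sentences $TR^n$ and $LO^n$ is HPL-independent of $choice_h^{(2)}$; that is, for every $n\ge1$ and $\varphi\in\{TR^n,LO^n\}$, neither $\varphi$ nor $\neg\varphi$ is derivable in second-order predicate logic with Henkin interpretation (HPL) from the axioms $choice_h^{(2)}$.
   Context: Predicates and structures: an $n$-ary predicate on a non-empty set $I$ is a function $\alpha:I^n\to\{true,false\}$. A predicate structure is a family $\Sigma=(J_n)_{n\ge0}$ with $J_0$ a non-empty set and, for $n\ge1$, $J_n$ a non-empty set of $n$-ary predicates on $J_0$. Second-order language and Henkin semantics: there are individual variables and, for each $n\ge1$, $n$-ary predicate variables; formulas are built from atomic formulas (predicate variables applied to tuples of individual variables, and identities between variables of the same sort) by the usual connectives and quantification over individual and predicate variables. In $\Sigma=(J_n)_{n\ge0}$, individual variables range over $J_0$ and $n$-ary predicate variables range over $J_n$. $\Sigma\models H$ means that $H$ is true in $\Sigma$ under all assignments. Henkin–Asser structure: a predicate structure $\Sigma=(J_n)_{n\ge0}$ closed under second-order definability, i.e. for every second-order formula $H$, every $n\ge1$, every tuple of distinct individual variables $x_1,\ldots,x_n$ and every assignment $f$ in $\Sigma$, the $n$-ary predicate mapping $(\xi_1,\ldots,\xi_n)\in J_0^n$ to the truth value of $H$ in $\Sigma$ under the assignment obtained from $f$ by mapping $x_j$ to $\xi_j$ belongs to $J_n$. HPL: derivability in HPL from a set $\mathcal{G}$ of formulas means derivability from ${}^hax^{(2)}\cup\mathcal{G}$, where ${}^hax^{(2)}$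 is the axiom system of HPL (including extensionality and the full comprehension schema). By Henkin's completeness theorem, a sentence $\varphi$ is derivable in HPL from $\mathcal{G}$ if and only if $\varphi$ is true in every Henkin–Asser structure $\Sigma$ with $\Sigma\models H$ for all $H\in\mathcal{G}$. The principles ($\boldsymbol{x},\boldsymbol{y}$ denote tuples of individual variables of the appropriate length): $TR^n$ (trichotomy) is the sentence saying that for all $n$-ary predicates $A,B$ there is a $2n$-ary predicate which is (the graph of) an injective mapping of $A$ into $B$, or there is a $2n$-ary predicate which is (the graph of) an injective mapping of $B$ into $A$ (here $A,B$ are identified with sets of $n$-tuples). $LO^n$ (linear ordering) is the sentence saying that for every $n$-ary predicate $A$ there is a $2n$-ary predicate $T$ that is a linear (total) ordering of the set of $n$-tuples satisfying $A$. $choice_h^{n,m}$ (Hilbert–Ackermann axioms of choice) is the set of all formulas $$\forall\boldsymbol{x}\,\exists D\,H(\boldsymbol{x},D)\;\to\;\exists S\,\forall\boldsymbol{x}\,\exists D\,\bigl(\forall\boldsymbol{y}\,(D\boldsymbol{y}\leftrightarrow S\boldsymbol{x}\boldsymbol{y})\wedge H(\boldsymbol{x},D)\bigr),$$ where $\boldsymbol{x}$ is an $n$-tuple and $\boldsymbol{y}$ an $m$-tuple of distinct individual variables, $D$ is an $m$-ary and $S$ an $(n+m)$-ary predicate variable, and $H(\boldsymbol{x},D)$ is any second-order formula, possibly with further free individual and predicate variables as parameters, in which $S$ and the variables $\boldsymbol{y}$ do not occur. Finally, $choice_h^{(2)}=\bigcup_{n,m\ge1}choice_h^{n,m}$. 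*)

theory Defs
  imports Main
begin

section \<open>The second-order language\<close>

text \<open>Individual variables are natural numbers; \<open>PV n i\<close> is the \<open>i\<close>-th \<open>n\<close>-ary predicate
  variable.  Only \<open>n \<ge> 1\<close> is admitted, which \<open>wff\<close> enforces.\<close>

datatype pvar = PV (arity: nat) nat

datatype fm =
    IdI nat nat
  | IdP pvar pvar
  | Atom pvar "nat list"
  | Neg fm
  | Imp fm fm
  | AllI nat fm
  | AllP pvar fm

abbreviation Conj :: "fm \<Rightarrow> fm \<Rightarrow> fm" where "Conj H K \<equiv> Neg (Imp H (Neg K))"
abbreviation Disj :: "fm \<Rightarrow> fm \<Rightarrow> fm" where "Disj H K \<equiv> Imp (Neg H) K"
abbreviation Iff :: "fm \<Rightarrow> fm \<Rightarrow> fm" where "Iff H K \<equiv> Conj (Imp H K) (Imp K H)"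
abbreviation ExI :: "nat \<Rightarrow> fm \<Rightarrow> fm" where "ExI x H \<equiv> Neg (AllI x (Neg H))"
abbreviation ExP :: "pvar \<Rightarrow> fm \<Rightarrow> fm" where "ExP P H \<equiv> Neg (AllP P (Neg H))"

definition AllIs :: "nat list \<Rightarrow> fm \<Rightarrow> fm" where "AllIs xs H = foldr AllI xs H"
definition ExIs :: "nat list \<Rightarrow> fm \<Rightarrow> fm" where "ExIs xs H = foldr (\<lambda>x K. ExI x K) xs H"

definition EqIs :: "nat list \<Rightarrow> nat list \<Rightarrow> fm" where
  "EqIs xs ys = foldr (\<lambda>H K. Conj H K) (map2 IdI xs ys) (AllI 0 (IdI 0 0))"

primrec wff :: "fm \<Rightarrow> bool" where
  "wff (IdI x y) \<longleftrightarrow> True"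
| "wff (IdP P Q) \<longleftrightarrow> 1 \<le> arity P \<and> arity P = arity Q"
| "wff (Atom P xs) \<longleftrightarrow> 1 \<le> arity P \<and> length xs = arity P"
| "wff (Neg H) \<longleftrightarrow> wff H"
| "wff (Imp H K) \<longleftrightarrow> wff H \<and> wff K"
| "wff (AllI x H) \<longleftrightarrow> wff H"
| "wff (AllP P H) \<longleftrightarrow> 1 \<le> arity P \<and> wff H"

text \<open>Variables occurring in a formula, free or bound (a quantifier prefix counts as an
  occurrence).\<close>

primrec occI :: "fm \<Rightarrow> nat set" where
  "occI (IdI x y) = {x, y}"
| "occI (IdP P Q) = {}"
| "occI (Atom P xs) = set xs"
| "occI (Neg H) = occI H"
| "occI (Imp H K) = occI H \<union> occI K"
| "occI (AllI x H) = insert x (occI H)"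
| "occI (AllP P H) = occI H"

primrec occP :: "fm \<Rightarrow> pvar set" where
  "occP (IdI x y) = {}"
| "occP (IdP P Q) = {P, Q}"
| "occP (Atom P xs) = {P}"
| "occP (Neg H) = occP H"
| "occP (Imp H K) = occP H \<union> occP K"
| "occP (AllI x H) = occP H"
| "occP (AllP P H) = insert P (occP H)"

primrec freeI :: "fm \<Rightarrow> nat set" where
  "freeI (IdI x y) = {x, y}"
| "freeI (IdP P Q) = {}"
| "freeI (Atom P xs) = set xs"
| "freeI (Neg H) = freeI H"
| "freeI (Imp H K) = freeI H \<union> freeI K"
| "freeI (AllI x H) = freeI H - {x}"
| "freeI (AllP P H) = freeI H"

primrec freeP :: "fm \<Rightarrow> pvar set" where
  "freeP (IdI x y) = {}"
| "freeP (IdP P Q) = {P, Q}"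
| "freeP (Atom P xs) = {P}"
| "freeP (Neg H) = freeP H"
| "freeP (Imp H K) = freeP H \<union> freeP K"
| "freeP (AllI x H) = freeP H"
| "freeP (AllP P H) = freeP H - {P}"

text \<open>\<open>substI x y H\<close> replaces the free occurrences of \<open>x\<close> in \<open>H\<close> by \<open>y\<close>, without renaming bound
  variables; it is used only when \<open>y\<close> is free for \<open>x\<close> in \<open>H\<close>.  Likewise for predicate variables.\<close>

primrec substI :: "nat \<Rightarrow> nat \<Rightarrow> fm \<Rightarrow> fm" where
  "substI x y (IdI u v) = IdI (if u = x then y else u) (if v = x then y else v)"
| "substI x y (IdP P Q) = IdP P Q"
| "substI x y (Atom P us) = Atom P (map (\<lambda>u. if u = x then y else u) us)"
| "substI x y (Neg H) = Neg (substI x y H)"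
| "substI x y (Imp H K) = Imp (substI x y H) (substI x y K)"
| "substI x y (AllI u H) = AllI u (if u = x then H else substI x y H)"
| "substI x y (AllP P H) = AllP P (substI x y H)"

primrec free_forI :: "nat \<Rightarrow> nat \<Rightarrow> fm \<Rightarrow> bool" where
  "free_forI y x (IdI u v) \<longleftrightarrow> True"
| "free_forI y x (IdP P Q) \<longleftrightarrow> True"
| "free_forI y x (Atom P us) \<longleftrightarrow> True"
| "free_forI y x (Neg H) \<longleftrightarrow> free_forI y x H"
| "free_forI y x (Imp H K) \<longleftrightarrow> free_forI y x H \<and> free_forI y x K"
| "free_forI y x (AllI u H) \<longleftrightarrow> x \<notin> freeI (AllI u H) \<or> (u \<noteq> y \<and> free_forI y x H)"
| "free_forI y x (AllP P H) \<longleftrightarrow> free_forI y x H"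

primrec substP :: "pvar \<Rightarrow> pvar \<Rightarrow> fm \<Rightarrow> fm" where
  "substP P Q (IdI u v) = IdI u v"
| "substP P Q (IdP R R') = IdP (if R = P then Q else R) (if R' = P then Q else R')"
| "substP P Q (Atom R us) = Atom (if R = P then Q else R) us"
| "substP P Q (Neg H) = Neg (substP P Q H)"
| "substP P Q (Imp H K) = Imp (substP P Q H) (substP P Q K)"
| "substP P Q (AllI u H) = AllI u (substP P Q H)"
| "substP P Q (AllP R H) = AllP R (if R = P then H else substP P Q H)"

primrec free_forP :: "pvar \<Rightarrow> pvar \<Rightarrow> fm \<Rightarrow> bool" where
  "free_forP Q P (IdI u v) \<longleftrightarrow> True"
| "free_forP Q P (IdP R R') \<longleftrightarrow> True"
| "free_forP Q P (Atom R us) \<longleftrightarrow> True"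
| "free_forP Q P (Neg H) \<longleftrightarrow> free_forP Q P H"
| "free_forP Q P (Imp H K) \<longleftrightarrow> free_forP Q P H \<and> free_forP Q P K"
| "free_forP Q P (AllI u H) \<longleftrightarrow> free_forP Q P H"
| "free_forP Q P (AllP R H) \<longleftrightarrow> P \<notin> freeP (AllP R H) \<or> (R \<noteq> Q \<and> free_forP Q P H)"

section \<open>Derivability in HPL\<close>

text \<open>A Hilbert-style axiom system for two-sorted (in fact \<open>\<omega>\<close>-sorted) predicate logic with identity,
  together with extensionality and full comprehension.  All formulas, in particular all axioms
  taken from a set \<open>G\<close>, may contain free variables; these are read universally, so that
  generalization is unrestricted (derivability then corresponds to truth in all Henkin-Asser
  structures in which every member of \<open>G\<close> holds under all assignments).\<close>

inductive_set hax2 :: "fm set" where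
  prop1: "wff H \<Longrightarrow> wff K \<Longrightarrow> Imp H (Imp K H) \<in> hax2"
| prop2: "wff H \<Longrightarrow> wff K \<Longrightarrow> wff L \<Longrightarrow>
    Imp (Imp H (Imp K L)) (Imp (Imp H K) (Imp H L)) \<in> hax2"
| prop3: "wff H \<Longrightarrow> wff K \<Longrightarrow> Imp (Imp (Neg H) (Neg K)) (Imp K H) \<in> hax2"
| instI: "wff H \<Longrightarrow> free_forI y x H \<Longrightarrow> Imp (AllI x H) (substI x y H) \<in> hax2"
| instP: "wff H \<Longrightarrow> 1 \<le> arity P \<Longrightarrow> arity Q = arity P \<Longrightarrow> free_forP Q P H \<Longrightarrow>
    Imp (AllP P H) (substP P Q H) \<in> hax2"
| distI: "wff H \<Longrightarrow> wff K \<Longrightarrow> x \<notin> freeI H \<Longrightarrow>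
    Imp (AllI x (Imp H K)) (Imp H (AllI x K)) \<in> hax2"
| distP: "wff H \<Longrightarrow> wff K \<Longrightarrow> 1 \<le> arity P \<Longrightarrow> P \<notin> freeP H \<Longrightarrow>
    Imp (AllP P (Imp H K)) (Imp H (AllP P K)) \<in> hax2"
| reflI: "IdI x x \<in> hax2"
| reflP: "1 \<le> arity P \<Longrightarrow> IdP P P \<in> hax2"
| leibnizI: "wff H \<Longrightarrow> free_forI y x H \<Longrightarrow> Imp (IdI x y) (Imp H (substI x y H)) \<in> hax2"
| leibnizP: "wff H \<Longrightarrow> 1 \<le> arity P \<Longrightarrow> arity Q = arity P \<Longrightarrow> free_forP Q P H \<Longrightarrow>
    Imp (IdP P Q) (Imp H (substP P Q H)) \<in> hax2"
| extensionality: "1 \<le> arity P \<Longrightarrow> arity Q = arity P \<Longrightarrow> length xs = arity P \<Longrightarrow> distinct xs \<Longrightarrow>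
    Imp (AllIs xs (Iff (Atom P xs) (Atom Q xs))) (IdP P Q) \<in> hax2"
| comprehension: "wff H \<Longrightarrow> 1 \<le> arity P \<Longrightarrow> length xs = arity P \<Longrightarrow> distinct xs \<Longrightarrow>
    P \<notin> freeP H \<Longrightarrow> ExP P (AllIs xs (Iff (Atom P xs) H)) \<in> hax2"

inductive HPL_derives :: "fm set \<Rightarrow> fm \<Rightarrow> bool" for G :: "fm set" where
  ax: "H \<in> hax2 \<union> G \<Longrightarrow> HPL_derives G H"
| mp: "HPL_derives G (Imp H K) \<Longrightarrow> HPL_derives G H \<Longrightarrow> HPL_derives G K"
| genI: "HPL_derives G H \<Longrightarrow> HPL_derives G (AllI x H)"
| genP: "HPL_derives G H \<Longrightarrow> 1 \<le> arity P \<Longrightarrow> HPL_derives G (AllP P H)"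

definition HPL_independent :: "fm \<Rightarrow> fm set \<Rightarrow> bool" where
  "HPL_independent \<phi> G \<longleftrightarrow> \<not> HPL_derives G \<phi> \<and> \<not> HPL_derives G (Neg \<phi>)"

section \<open>The principles\<close>

text \<open>\<open>F\<close> is the graph of an injective mapping of \<open>A\<close> into \<open>B\<close>.\<close>

definition inj_map_fm :: "nat \<Rightarrow> pvar \<Rightarrow> pvar \<Rightarrow> pvar \<Rightarrow> fm" where
  "inj_map_fm n F A B =
    (let x = [0..<n]; y = [n..<2*n]; z = [2*n..<3*n] in
      Conj (AllIs (x @ y) (Imp (Atom F (x @ y)) (Conj (Atom A x) (Atom B y))))
     (Conj (AllIs x (Imp (Atom A x) (ExIs y (Atom F (x @ y)))))
     (Conj (AllIs (x @ y @ z) (Imp (Conj (Atom F (x @ y)) (Atom F (x @ z))) (EqIs y z)))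
           (AllIs (x @ y @ z) (Imp (Conj (Atom F (x @ z)) (Atom F (y @ z))) (EqIs x y))))))"

definition TR :: "nat \<Rightarrow> fm" where
  "TR n = (let A = PV n 0; B = PV n 1; F = PV (2*n) 0 in
    AllP A (AllP B (Disj (ExP F (inj_map_fm n F A B)) (ExP F (inj_map_fm n F B A)))))"

text \<open>\<open>T\<close> is a (reflexive) linear ordering with field \<open>A\<close>.\<close>

definition lin_ord_fm :: "nat \<Rightarrow> pvar \<Rightarrow> pvar \<Rightarrow> fm" where
  "lin_ord_fm n T A =
    (let x = [0..<n]; y = [n..<2*n]; z = [2*n..<3*n] in
      Conj (AllIs (x @ y) (Imp (Atom T (x @ y)) (Conj (Atom A x) (Atom A y))))
     (Conj (AllIs x (Imp (Atom A x) (Atom T (x @ x))))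
     (Conj (AllIs (x @ y) (Imp (Conj (Atom T (x @ y)) (Atom T (y @ x))) (EqIs x y)))
     (Conj (AllIs (x @ y @ z)
              (Imp (Conj (Atom T (x @ y)) (Atom T (y @ z))) (Atom T (x @ z))))
           (AllIs (x @ y)
              (Imp (Conj (Atom A x) (Atom A y)) (Disj (Atom T (x @ y)) (Atom T (y @ x)))))))))"

definition LO :: "nat \<Rightarrow> fm" where
  "LO n = (let A = PV n 0; T = PV (2*n) 0 in AllP A (ExP T (lin_ord_fm n T A)))"

definition choice_h :: "nat \<Rightarrow> nat \<Rightarrow> fm set" where
  "choice_h n m =
    {Imp (AllIs x (ExP D H))
         (ExP S (AllIs x (ExP D (Conj (AllIs y (Iff (Atom D y) (Atom S (x @ y)))) H))))
     | x y D S H.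
        length x = n \<and> length y = m \<and> distinct (x @ y) \<and> arity D = m \<and> arity S = n + m \<and>
        wff H \<and> S \<notin> occP H \<and> set y \<inter> occI H = {}}"

definition choice_h2 :: "fm set" where
  "choice_h2 = (\<Union>n\<in>{1..}. \<Union>m\<in>{1..}. choice_h n m)"

section \<open>Consistency of ZFC\<close>

text \<open>The first-order language of set theory with identity, a Hilbert calculus for it, and the ZFC
  axioms.  Axioms with free variables stand for their universal closures.\<close>

datatype sfm =
    SEq nat nat
  | SMem nat nat
  | SNeg sfm
  | SImp sfm sfm
  | SAll nat sfm

abbreviation SConj :: "sfm \<Rightarrow> sfm \<Rightarrow> sfm" where "SConj p q \<equiv> SNeg (SImp p (SNeg q))"
abbreviation SDisj :: "sfm \<Rightarrow> sfm \<Rightarrow> sfm" where "SDisj p q \<equiv> SImp (SNeg p) q"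
abbreviation SIff :: "sfm \<Rightarrow> sfm \<Rightarrow> sfm" where "SIff p q \<equiv> SConj (SImp p q) (SImp q p)"
abbreviation SEx :: "nat \<Rightarrow> sfm \<Rightarrow> sfm" where "SEx x p \<equiv> SNeg (SAll x (SNeg p))"

primrec socc :: "sfm \<Rightarrow> nat set" where
  "socc (SEq x y) = {x, y}"
| "socc (SMem x y) = {x, y}"
| "socc (SNeg p) = socc p"
| "socc (SImp p q) = socc p \<union> socc q"
| "socc (SAll x p) = insert x (socc p)"

primrec sfree :: "sfm \<Rightarrow> nat set" where
  "sfree (SEq x y) = {x, y}"
| "sfree (SMem x y) = {x, y}"
| "sfree (SNeg p) = sfree p"
| "sfree (SImp p q) = sfree p \<union> sfree q"
| "sfree (SAll x p) = sfree p - {x}"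

primrec ssubst :: "nat \<Rightarrow> nat \<Rightarrow> sfm \<Rightarrow> sfm" where
  "ssubst x y (SEq u v) = SEq (if u = x then y else u) (if v = x then y else v)"
| "ssubst x y (SMem u v) = SMem (if u = x then y else u) (if v = x then y else v)"
| "ssubst x y (SNeg p) = SNeg (ssubst x y p)"
| "ssubst x y (SImp p q) = SImp (ssubst x y p) (ssubst x y q)"
| "ssubst x y (SAll u p) = SAll u (if u = x then p else ssubst x y p)"

primrec sfree_for :: "nat \<Rightarrow> nat \<Rightarrow> sfm \<Rightarrow> bool" where
  "sfree_for y x (SEq u v) \<longleftrightarrow> True"
| "sfree_for y x (SMem u v) \<longleftrightarrow> True"
| "sfree_for y x (SNeg p) \<longleftrightarrow> sfree_for y x p"
| "sfree_for y x (SImp p q) \<longleftrightarrow> sfree_for y x p \<and> sfree_for y x q"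
| "sfree_for y x (SAll u p) \<longleftrightarrow> x \<notin> sfree (SAll u p) \<or> (u \<noteq> y \<and> sfree_for y x p)"

inductive fol_derives :: "sfm set \<Rightarrow> sfm \<Rightarrow> bool" for G :: "sfm set" where
  s_ax: "p \<in> G \<Longrightarrow> fol_derives G p"
| s_prop1: "fol_derives G (SImp p (SImp q p))"
| s_prop2: "fol_derives G (SImp (SImp p (SImp q r)) (SImp (SImp p q) (SImp p r)))"
| s_prop3: "fol_derives G (SImp (SImp (SNeg p) (SNeg q)) (SImp q p))"
| s_inst: "sfree_for y x p \<Longrightarrow> fol_derives G (SImp (SAll x p) (ssubst x y p))"
| s_dist: "x \<notin> sfree p \<Longrightarrow> fol_derives G (SImp (SAll x (SImp p q)) (SImp p (SAll x q)))"
| s_refl: "fol_derives G (SEq x x)"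
| s_leibniz: "sfree_for y x p \<Longrightarrow> fol_derives G (SImp (SEq x y) (SImp p (ssubst x y p)))"
| s_mp: "fol_derives G (SImp p q) \<Longrightarrow> fol_derives G p \<Longrightarrow> fol_derives G q"
| s_gen: "fol_derives G p \<Longrightarrow> fol_derives G (SAll x p)"

inductive_set ZFC :: "sfm set" where
  zf_extensionality:
    "SImp (SAll 2 (SIff (SMem 2 0) (SMem 2 1))) (SEq 0 1) \<in> ZFC"
| zf_foundation:
    "SImp (SEx 1 (SMem 1 0)) (SEx 1 (SConj (SMem 1 0) (SNeg (SEx 2 (SConj (SMem 2 0) (SMem 2 1)))))) \<in> ZFC"
| zf_pairing:
    "SEx 2 (SAll 3 (SIff (SMem 3 2) (SDisj (SEq 3 0) (SEq 3 1)))) \<in> ZFC"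
| zf_union:
    "SEx 1 (SAll 2 (SIff (SMem 2 1) (SEx 3 (SConj (SMem 2 3) (SMem 3 0))))) \<in> ZFC"
| zf_power_set:
    "SEx 1 (SAll 2 (SIff (SMem 2 1) (SAll 3 (SImp (SMem 3 2) (SMem 3 0))))) \<in> ZFC"
| zf_infinity:
    "SEx 0 (SConj (SEx 1 (SConj (SMem 1 0) (SAll 2 (SNeg (SMem 2 1)))))
       (SAll 1 (SImp (SMem 1 0)
         (SEx 2 (SConj (SMem 2 0) (SAll 3 (SIff (SMem 3 2) (SDisj (SMem 3 1) (SEq 3 1))))))))) \<in> ZFC"
| zf_separation:
    "distinct [x, a, b] \<Longrightarrow> b \<notin> sfree p \<Longrightarrow>
       SEx b (SAll x (SIff (SMem x b) (SConj (SMem x a) p))) \<in> ZFC"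
| zf_replacement:
    "distinct [x, y, y', a, b] \<Longrightarrow> y' \<notin> socc p \<Longrightarrow> b \<notin> sfree p \<Longrightarrow>
       SImp (SAll x (SAll y (SAll y' (SImp (SConj p (ssubst y y' p)) (SEq y y')))))
         (SEx b (SAll y (SIff (SMem y b) (SEx x (SConj (SMem x a) p))))) \<in> ZFC"
| zf_choice: \<comment> \<open>every set of pairwise disjoint nonempty sets has a transversal\<close>
    "SImp (SConj (SAll 1 (SImp (SMem 1 0) (SEx 2 (SMem 2 1))))
        (SAll 1 (SAll 2 (SImp (SConj (SConj (SMem 1 0) (SMem 2 0)) (SNeg (SEq 1 2)))
           (SNeg (SEx 3 (SConj (SMem 3 1) (SMem 3 2))))))))
      (SEx 4 (SAll 1 (SImp (SMem 1 0)
         (SEx 2 (SAll 3 (SIff (SConj (SMem 3 1) (SMem 3 4)) (SEq 3 2))))))) \<in> ZFC"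

definition consistent :: "sfm set \<Rightarrow> bool" where
  "consistent G \<longleftrightarrow> \<not> (\<exists>p. fol_derives G p \<and> fol_derives G (SNeg p))"

end

(* Both independence claims come from one construction. Fix a two-colouring of the individuals and
   take as predicates those invariant under all colour-preserving permutations that fix some finite
   set pointwise. This is a Henkin-Asser structure, since definable predicates inherit finite
   supports from their parameters. It satisfies the choice axioms: for a single variable x, one
   witness at a generic individual can be transported along transpositions to all but finitely many
   individuals of the same colour, and tuples follow by induction on their length. With infinitely
   many individuals of each colour, transposing two individuals outside a support refutes any linear
   ordering of the n-tuples and any injection between the monochromatic n-tuples of the two
   colours, so TR and LO fail. With a single individual both hold. *)

theory Submission
  imports Defs "HOL-Combinatorics.Transposition"
begin

section \<open>Henkin semantics and soundness\<close>

text \<open>The individual domain is the whole type \<open>'a\<close>, so a structure is given by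
  its predicate domains \<open>J\<close> alone; that \<open>f\<close> takes values in them is
  imposed separately by \<open>assignment\<close>.\<close>

primrec sat ::
  "(nat \<Rightarrow> ('a list \<Rightarrow> bool) set) \<Rightarrow> (nat \<Rightarrow> 'a) \<Rightarrow> (pvar \<Rightarrow> 'a list \<Rightarrow> bool) \<Rightarrow> fm \<Rightarrow> bool" where
  "sat J e f (IdI x y) \<longleftrightarrow> e x = e y"
| "sat J e f (IdP P Q) \<longleftrightarrow> f P = f Q"
| "sat J e f (Atom P xs) \<longleftrightarrow> f P (map e xs)"
| "sat J e f (Neg H) \<longleftrightarrow> \<not> sat J e f H"
| "sat J e f (Imp H K) \<longleftrightarrow> (sat J e f H \<longrightarrow> sat J e f K)"
| "sat J e f (AllI x H) \<longleftrightarrow> (\<forall>a. sat J (e(x := a)) f H)"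
| "sat J e f (AllP P H) \<longleftrightarrow> (\<forall>p\<in>J (arity P). sat J e (f(P := p)) H)"

text \<open>Values are assigned from the left, in the order in which the \<open>foldr\<close>
  prefixes of \<open>AllIs\<close> and \<open>ExIs\<close> are evaluated.\<close>

fun upd :: "(nat \<Rightarrow> 'a) \<Rightarrow> nat list \<Rightarrow> 'a list \<Rightarrow> nat \<Rightarrow> 'a" where
  "upd e (x # xs) (v # vs) = upd (e(x := v)) xs vs"
| "upd e xs vs = e"

lemma upd_notin: "z \<notin> set xs \<Longrightarrow> upd e xs vs z = e z"
  by (induction e xs vs rule: upd.induct) auto

lemma map_upd_same [simp]: "distinct xs \<Longrightarrow> length vs = length xs \<Longrightarrow> map (upd e xs vs) xs = vs"
  by (induction e xs vs rule: upd.induct) (auto simp: upd_notin)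

lemma map_upd_disjoint [simp]: "set ys \<inter> set xs = {} \<Longrightarrow> map (upd e xs vs) ys = map e ys"
  by (auto simp: upd_notin disjoint_iff)

lemma upd_equivariant:
  "g (e v) = e' v \<Longrightarrow> length vs = length xs \<Longrightarrow> upd e' xs (map g vs) v = g (upd e xs vs v)"
  by (induction e xs vs arbitrary: e' rule: upd.induct) auto

lemma ex_length_Suc: "(\<exists>vs. length vs = Suc n \<and> Q vs) \<longleftrightarrow> (\<exists>a vs. length vs = n \<and> Q (a # vs))"
  by (metis length_Suc_conv)

lemma all_length_Suc: "(\<forall>vs. length vs = Suc n \<longrightarrow> Q vs) \<longleftrightarrow> (\<forall>a vs. length vs = n \<longrightarrow> Q (a # vs))"
  by (metis length_Suc_conv)

text \<open>This and the next lemma evaluate connectives encoded with \<open>Neg\<close> as wholes,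
  so that the long formulas of the principles can be unfolded without the general clause for
  \<open>Neg\<close>.\<close>

lemma sat_Conj: "sat J e f (Conj H K) \<longleftrightarrow> sat J e f H \<and> sat J e f K"
  by simp

lemma sat_Neg_Atom: "sat J e f (Neg (Atom P xs)) \<longleftrightarrow> \<not> f P (map e xs)"
  by simp

lemma sat_AllIs:
  "sat J e f (AllIs xs H) \<longleftrightarrow> (\<forall>vs. length vs = length xs \<longrightarrow> sat J (upd e xs vs) f H)"
proof (induction xs arbitrary: e)
  case (Cons x xs)
  then show ?case unfolding AllIs_def by (simp add: all_length_Suc fun_upd_def)
qed (simp add: AllIs_def)

lemma sat_ExIs:
  "sat J e f (ExIs xs H) \<longleftrightarrow> (\<exists>vs. length vs = length xs \<and> sat J (upd e xs vs) f H)"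
proof (induction xs arbitrary: e)
  case (Cons x xs)
  then show ?case unfolding ExIs_def by (simp add: ex_length_Suc fun_upd_def)
qed (simp add: ExIs_def)

lemma AllIs_append: "AllIs (xs @ ys) H = AllIs xs (AllIs ys H)"
  by (simp add: AllIs_def)

lemma sat_EqIs: "length xs = length ys \<Longrightarrow> sat J e f (EqIs xs ys) \<longleftrightarrow> map e xs = map e ys"
  unfolding EqIs_def by (induction xs ys rule: list_induct2) auto

section \<open>Dependence on free variables, and the substitution lemmas\<close>

lemma sat_cong:
  "(\<And>v. v \<in> freeI H \<Longrightarrow> e v = e' v) \<Longrightarrow> (\<And>P. P \<in> freeP H \<Longrightarrow> f P = f' P) \<Longrightarrow>
    sat J e f H \<longleftrightarrow> sat J e' f' H"
proof (induction H arbitrary: e e' f f')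
  case (Atom P xs)
  then have "map e xs = map e' xs" "f P = f' P" by auto
  then show ?case by (simp only: sat.simps)
next
  case (Imp H K)
  from Imp.IH(1)[of e e' f f'] Imp.IH(2)[of e e' f f'] Imp.prems show ?case by simp
next
  case (AllI x H)
  have "sat J (e(x := a)) f H = sat J (e'(x := a)) f' H" for a
    by (rule AllI.IH) (use AllI.prems in auto)
  then show ?case by simp
next
  case (AllP P H)
  have "sat J e (f(P := p)) H = sat J e' (f'(P := p)) H" for p
    by (rule AllP.IH) (use AllP.prems in auto)
  then show ?case by simp
next
  case (Neg H)
  from Neg.IH[of e e' f f'] Neg.prems show ?case by simp
qed auto

lemma finite_freeI: "finite (freeI H)" and finite_freeP: "finite (freeP H)"
  by (induction H) auto

lemma freeP_subset_occP: "freeP H \<subseteq> occP H"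
  by (induction H) auto

lemma substI_not_free: "x \<notin> freeI H \<Longrightarrow> substI x y H = H"
  by (induction H) (auto intro!: map_idI)

lemma substP_not_free: "P \<notin> freeP H \<Longrightarrow> substP P Q H = H"
  by (induction H) auto

lemma sat_substI:
  "free_forI y x H \<Longrightarrow> sat J e f (substI x y H) \<longleftrightarrow> sat J (e(x := e y)) f H"
proof (induction H arbitrary: e f)
  case (Atom P us)
  have "map e (map (\<lambda>u. if u = x then y else u) us) = map (e(x := e y)) us" by simp
  then show ?case by (simp only: substI.simps sat.simps)
next
  case (AllI u H)
  show ?case
  proof (cases "x \<in> freeI (AllI u H)")
    case True
    then have "u \<noteq> y" "free_forI y x H" "u \<noteq> x" using AllI.prems by auto
    then show ?thesis using AllI.IH by (simp add: fun_upd_twist[of x u] del: fun_upd_apply) simp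
  next
    case False
    \<comment> \<open>Here \<open>free_forI\<close> allows \<open>u\<close> to equal
      \<open>y\<close>, but no occurrence is replaced, so nothing can be captured.\<close>
    then have "substI x y (AllI u H) = AllI u H" by (rule substI_not_free)
    moreover have "sat J e f (AllI u H) \<longleftrightarrow> sat J (e(x := e y)) f (AllI u H)"
      by (rule sat_cong) (use False in auto)
    ultimately show ?thesis by (simp only:)
  qed
qed auto

lemma sat_substP:
  "free_forP Q P H \<Longrightarrow> sat J e f (substP P Q H) \<longleftrightarrow> sat J e (f(P := f Q)) H"
proof (induction H arbitrary: e f)
  case (AllP R H)
  show ?case
  proof (cases "P \<in> freeP (AllP R H)")
    case True
    then have "R \<noteq> Q" "free_forP Q P H" "R \<noteq> P" using AllP.prems by auto
    then show ?thesis using AllP.IH by (simp add: fun_upd_twist[of P R] del: fun_upd_apply) simp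
  next
    case False
    then have "substP P Q (AllP R H) = AllP R H" by (rule substP_not_free)
    moreover have "sat J e f (AllP R H) \<longleftrightarrow> sat J e (f(P := f Q)) (AllP R H)"
      by (rule sat_cong) (use False in auto)
    ultimately show ?thesis by (simp only:)
  qed
qed auto

section \<open>Henkin-Asser structures and soundness of the calculus\<close>

definition assignment :: "(nat \<Rightarrow> ('a list \<Rightarrow> bool) set) \<Rightarrow> (pvar \<Rightarrow> 'a list \<Rightarrow> bool) \<Rightarrow> bool" where
  "assignment J f \<longleftrightarrow> (\<forall>P. f P \<in> J (arity P))"

definition valid :: "(nat \<Rightarrow> ('a list \<Rightarrow> bool) set) \<Rightarrow> fm \<Rightarrow> bool" where
  "valid J H \<longleftrightarrow> (\<forall>e f. assignment J f \<longrightarrow> sat J e f H)"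

lemma assignment_upd: "assignment J f \<Longrightarrow> p \<in> J (arity P) \<Longrightarrow> assignment J (f(P := p))"
  by (simp add: assignment_def)

text \<open>A predicate is a function on lists of all lengths; \<open>length_cond\<close> forces it to be false
  on lists of the wrong length, so that identity of predicates is extensional.\<close>

locale henkin_asser =
  fixes J :: "nat \<Rightarrow> ('a list \<Rightarrow> bool) set"
  assumes nonempty: "J n \<noteq> {}"
    and length_cond: "p \<in> J n \<Longrightarrow> p vs \<Longrightarrow> length vs = n"
    and definable: "assignment J f \<Longrightarrow> distinct xs \<Longrightarrow>
      (\<lambda>vs. length vs = length xs \<and> sat J (upd e xs vs) f H) \<in> J (length xs)"
begin

lemma hax2_valid: "H \<in> hax2 \<Longrightarrow> valid J H"
  unfolding valid_def
proof (intro allI impI)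
  fix e f
  assume "H \<in> hax2" and f: "assignment J f"
  then show "sat J e f H"
  proof (induction rule: hax2.induct)
    case (instI H y x)
    then show ?case by (simp add: sat_substI)
  next
    case (instP H P Q)
    then have "f Q \<in> J (arity P)" using f unfolding assignment_def by metis
    with instP show ?case by (simp add: sat_substP)
  next
    case (distI H K x)
    have "sat J (e(x := a)) f H = sat J e f H" for a
      by (rule sat_cong) (use distI in auto)
    then show ?case by simp
  next
    case (distP H K P)
    have "sat J e (f(P := p)) H = sat J e f H" for p
      by (rule sat_cong) (use distP in auto)
    then show ?case by simp
  next
    case (leibnizI H y x)
    have "e x = e y \<Longrightarrow> e(x := e y) = e" by auto
    with leibnizI show ?case by (simp add: sat_substI)
  next
    case (leibnizP H P Q)
    have "f P = f Q \<Longrightarrow> f(P := f Q) = f" by auto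
    with leibnizP show ?case by (simp add: sat_substP)
  next
    case (extensionality P Q xs)
    \<comment> \<open>The quantified equivalence speaks only of lists of the right length; on all
      others both predicates are false by \<open>length_cond\<close>.\<close>
    have "f P = f Q" if "\<And>vs. length vs = length xs \<Longrightarrow> f P vs = f Q vs"
    proof
      fix vs
      show "f P vs = f Q vs"
        using that[of vs] extensionality length_cond[of "f P" "arity P" vs]
          length_cond[of "f Q" "arity P" vs]
        unfolding assignment_def by metis
    qed
    then show ?case using extensionality by (auto simp: sat_AllIs)
  next
    case (comprehension H P xs)
    \<comment> \<open>The witness is the predicate defined by \<open>H\<close>; since
      \<open>P\<close> is not free in \<open>H\<close>, assigning it to \<open>P\<close> leaves the
      truth value of \<open>H\<close> unchanged.\<close>
    define p where "p = (\<lambda>vs. length vs = length xs \<and> sat J (upd e xs vs) f H)"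
    have "p \<in> J (arity P)"
      unfolding p_def comprehension(3)[symmetric]
      by (rule definable) (use f comprehension in auto)
    moreover have "sat J (upd e xs vs) (f(P := p)) H = p vs" if "length vs = length xs" for vs
      unfolding p_def using that
      by (simp, intro sat_cong) (use comprehension in auto)
    ultimately show ?case using comprehension by (auto simp: sat_AllIs intro!: bexI[of _ p])
  qed auto
qed

lemma soundness:
  assumes "HPL_derives G H" "\<And>K. K \<in> G \<Longrightarrow> valid J K"
  shows "valid J H"
  using assms(1)
proof (induction rule: HPL_derives.induct)
  case (ax H)
  then show ?case using hax2_valid assms(2) by auto
qed (auto simp: valid_def assignment_upd)

lemma ex_assignment: "\<exists>f. assignment J f"
proof
  show "assignment J (\<lambda>P. SOME p. p \<in> J (arity P))"
    unfolding assignment_def using nonempty by (simp add: some_in_eq)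
qed

text \<open>Some assignment exists because no predicate domain is empty, so a formula that is false
  under all assignments is not valid.\<close>

lemma not_derivable:
  assumes "\<And>K. K \<in> G \<Longrightarrow> valid J K" "\<And>e f. assignment J f \<Longrightarrow> \<not> sat J e f H"
  shows "\<not> HPL_derives G H"
  using soundness[of G H] assms ex_assignment unfolding valid_def by blast

end

section \<open>Finitely supported predicates\<close>

text \<open>This is the pointwise stabilizer of \<open>E\<close> in the group of colour-preserving
  permutations; the full group is the case \<open>E = {}\<close>.\<close>

definition colour_perms :: "('a \<Rightarrow> bool) \<Rightarrow> 'a set \<Rightarrow> ('a \<Rightarrow> 'a) set" where
  "colour_perms col E = {g. bij g \<and> (\<forall>a. col (g a) = col a) \<and> (\<forall>a\<in>E. g a = a)}"

definition supports :: "('a \<Rightarrow> bool) \<Rightarrow> 'a set \<Rightarrow> ('a list \<Rightarrow> bool) \<Rightarrow> bool" where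
  "supports col E p \<longleftrightarrow> (\<forall>g\<in>colour_perms col E. \<forall>xs. p (map g xs) = p xs)"

definition finsupp :: "('a \<Rightarrow> bool) \<Rightarrow> ('a list \<Rightarrow> bool) \<Rightarrow> bool" where
  "finsupp col p \<longleftrightarrow> (\<exists>E. finite E \<and> supports col E p)"

text \<open>These are the symmetric predicates in the sense of permutation models, with finite sets
  as supports.\<close>

definition fs_preds :: "('a \<Rightarrow> bool) \<Rightarrow> nat \<Rightarrow> ('a list \<Rightarrow> bool) set" where
  "fs_preds col n = {p. finsupp col p \<and> (\<forall>xs. p xs \<longrightarrow> length xs = n)}"

text \<open>The inverse makes this a left action and gives \<open>act g p (map g xs) = p xs\<close>
  for bijective \<open>g\<close>, so predicates and tuples move together.\<close>

definition act :: "('a \<Rightarrow> 'a) \<Rightarrow> ('a list \<Rightarrow> bool) \<Rightarrow> 'a list \<Rightarrow> bool" where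
  "act g p = (\<lambda>xs. p (map (inv g) xs))"

lemma colour_perms_mono: "E \<subseteq> E' \<Longrightarrow> g \<in> colour_perms col E' \<Longrightarrow> g \<in> colour_perms col E"
  by (auto simp: colour_perms_def)

lemma colour_perms_bij: "g \<in> colour_perms col E \<Longrightarrow> bij g"
  by (simp add: colour_perms_def)

lemma colour_perms_comp:
  "g \<in> colour_perms col E \<Longrightarrow> h \<in> colour_perms col E \<Longrightarrow> g \<circ> h \<in> colour_perms col E"
  by (auto simp: colour_perms_def bij_comp)

lemma colour_perms_inv:
  assumes "g \<in> colour_perms col E"
  shows "inv g \<in> colour_perms col E"
proof -
  have g: "bij g" "\<And>a. col (g a) = col a" "\<And>a. a \<in> E \<Longrightarrow> g a = a"
    using assms by (auto simp: colour_perms_def)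
  moreover have "col (inv g a) = col a" for a
    using g(2)[of "inv g a"] g(1) by (simp add: bij_is_surj surj_f_inv_f)
  moreover have "inv g a = a" if "a \<in> E" for a
    using g(3)[OF that] g(1) by (metis bij_is_inj inv_f_f)
  ultimately show ?thesis by (simp add: colour_perms_def bij_imp_bij_inv)
qed

lemma colour_perms_transpose:
  "col a = col b \<Longrightarrow> a \<notin> E \<Longrightarrow> b \<notin> E \<Longrightarrow> transpose a b \<in> colour_perms col E"
  by (auto simp: colour_perms_def transpose_def)

lemma supportsD: "supports col E p \<Longrightarrow> g \<in> colour_perms col E \<Longrightarrow> p (map g xs) = p xs"
  by (simp add: supports_def)

lemma supports_act_eq: "supports col E p \<Longrightarrow> g \<in> colour_perms col E \<Longrightarrow> act g p = p"
  unfolding act_def using supportsD colour_perms_inv by fastforce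

lemma act_map [simp]: "bij g \<Longrightarrow> act g p (map g xs) = p xs"
  by (simp add: act_def bij_is_inj)

lemma act_comp: "bij g \<Longrightarrow> bij h \<Longrightarrow> act (g \<circ> h) p = act g (act h p)"
  by (simp add: act_def o_inv_distrib)

lemma act_inv: "bij g \<Longrightarrow> act g (act (inv g) p) = p"
  by (auto simp: act_def inv_inv_eq comp_def bij_is_surj surj_f_inv_f)

lemma act_inv_left: "bij g \<Longrightarrow> act (inv g) (act g p) = p"
  by (auto simp: act_def inv_inv_eq comp_def bij_is_inj)

lemma act_inject: "bij g \<Longrightarrow> act g p = act g q \<longleftrightarrow> p = q"
  by (metis act_inv_left)

text \<open>Conjugation by \<open>g\<close> turns a permutation fixing the image of \<open>E\<close>
  into one fixing \<open>E\<close>.\<close>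

lemma supports_act:
  assumes p: "supports col E p" and g: "g \<in> colour_perms col {}"
  shows "supports col (g ` E) (act g p)"
  unfolding supports_def
proof (intro ballI allI)
  fix h xs
  assume h: "h \<in> colour_perms col (g ` E)"
  have bij: "bij g" using g by (rule colour_perms_bij)
  have "inv g \<circ> h \<circ> g \<in> colour_perms col {}"
    using colour_perms_mono[OF _ h, of "{}"] g by (intro colour_perms_comp colour_perms_inv) auto
  moreover have "(inv g \<circ> h \<circ> g) a = a" if "a \<in> E" for a
    using h that bij by (auto simp: colour_perms_def bij_is_inj)
  ultimately have "inv g \<circ> h \<circ> g \<in> colour_perms col E" by (simp add: colour_perms_def)
  then have "p (map (inv g \<circ> h \<circ> g) (map (inv g) xs)) = p (map (inv g) xs)" by (rule supportsD[OF p])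
  then show "act g p (map h xs) = act g p xs"
    using bij by (simp add: act_def comp_def bij_is_surj surj_f_inv_f)
qed

section \<open>Invariance of the predicate domains and of truth under the action\<close>

lemma finsupp_act: "g \<in> colour_perms col {} \<Longrightarrow> finsupp col p \<Longrightarrow> finsupp col (act g p)"
  unfolding finsupp_def using supports_act by blast

lemma fs_preds_act: "g \<in> colour_perms col {} \<Longrightarrow> p \<in> fs_preds col n \<Longrightarrow> act g p \<in> fs_preds col n"
  using finsupp_act by (fastforce simp: fs_preds_def act_def)

text \<open>A permutation maps the individuals and each predicate domain bijectively onto
  themselves, so the quantifiers on both sides range over corresponding values.\<close>

lemma sat_equivariant:
  assumes g: "g \<in> colour_perms col {}"
  shows "sat (fs_preds col) (g \<circ> e) (\<lambda>P. act g (f P)) H \<longleftrightarrow> sat (fs_preds col) e f H"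
proof (induction H arbitrary: e f)
  case (IdI x y)
  show ?case using colour_perms_bij[OF g] by (simp add: bij_is_inj inj_eq)
next
  case (IdP P Q)
  show ?case using colour_perms_bij[OF g] by (simp add: act_inject)
next
  case (Atom P xs)
  show ?case using act_map[OF colour_perms_bij[OF g], of "f P" "map e xs"] by (simp add: comp_def)
next
  case (AllI x H)
  have "(g \<circ> e)(x := g a) = g \<circ> e(x := a)" for a by auto
  then have IH: "sat (fs_preds col) ((g \<circ> e)(x := g a)) (\<lambda>P. act g (f P)) H \<longleftrightarrow>
      sat (fs_preds col) (e(x := a)) f H" for a
    by (simp only: AllI.IH)
  have "b = g (inv g b)" for b
    by (simp add: surj_f_inv_f bij_is_surj colour_perms_bij[OF g])
  with IH show ?case unfolding sat.simps by metis
next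
  case (AllP P H)
  have upd: "(\<lambda>P. act g (f P))(P := act g p) = (\<lambda>R. act g ((f(P := p)) R))" for p by auto
  show ?case
  proof
    assume L: "sat (fs_preds col) (g \<circ> e) (\<lambda>P. act g (f P)) (AllP P H)"
    show "sat (fs_preds col) e f (AllP P H)"
      unfolding sat.simps
    proof
      fix p assume "p \<in> fs_preds col (arity P)"
      with L have "sat (fs_preds col) (g \<circ> e) ((\<lambda>P. act g (f P))(P := act g p)) H"
        using fs_preds_act[OF g] by auto
      then show "sat (fs_preds col) e (f(P := p)) H" unfolding upd AllP.IH .
    qed
  next
    assume R: "sat (fs_preds col) e f (AllP P H)"
    show "sat (fs_preds col) (g \<circ> e) (\<lambda>P. act g (f P)) (AllP P H)"
      unfolding sat.simps
    proof
      fix p assume p: "p \<in> fs_preds col (arity P)"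
      define q where "q = act (inv g) p"
      have pq: "p = act g q" unfolding q_def using colour_perms_bij[OF g] by (simp add: act_inv)
      have "q \<in> fs_preds col (arity P)"
        using p unfolding q_def by (intro fs_preds_act colour_perms_inv g)
      with R have "sat (fs_preds col) e (f(P := q)) H" by simp
      then show "sat (fs_preds col) (g \<circ> e) ((\<lambda>P. act g (f P))(P := p)) H"
        unfolding pq upd AllP.IH .
    qed
  qed
qed auto

text \<open>Only finitely many variables are free in \<open>H\<close>, so the values of the
  individual ones and the supports of the predicate ones form a finite set. The whole assignment
  need not have a finite support.\<close>

lemma sat_supported:
  fixes e :: "nat \<Rightarrow> 'a"
  assumes f: "assignment (fs_preds col) f"
  obtains E where "finite E" "\<And>g v. g \<in> colour_perms col E \<Longrightarrow> v \<in> freeI H \<Longrightarrow> g (e v) = e v"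
    "\<And>g P. g \<in> colour_perms col E \<Longrightarrow> P \<in> freeP H \<Longrightarrow> act g (f P) = f P"
proof -
  have "\<exists>E. finite E \<and> supports col E (f P)" for P
    using f by (auto simp: assignment_def fs_preds_def finsupp_def)
  then obtain s where s: "\<And>P. finite (s P)" "\<And>P. supports col (s P) (f P)" by metis
  let ?E = "e ` freeI H \<union> (\<Union>P\<in>freeP H. s P)"
  show thesis
  proof (rule that[of ?E])
    show "finite ?E" using s finite_freeI finite_freeP by blast
    show "g (e v) = e v" if "g \<in> colour_perms col ?E" "v \<in> freeI H" for g v
      using that by (auto simp: colour_perms_def)
    show "act g (f P) = f P" if "g \<in> colour_perms col ?E" "P \<in> freeP H" for g P
      by (rule supports_act_eq[OF s(2)], rule colour_perms_mono[OF _ that(1)]) (use that(2) in auto)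
  qed
qed

lemma fs_preds_henkin_asser: "henkin_asser (fs_preds col)"
proof
  fix n
  have "(\<lambda>xs. False) \<in> fs_preds col n" by (auto simp: fs_preds_def finsupp_def supports_def)
  then show "fs_preds col n \<noteq> {}" by blast
next
  fix p n xs
  assume "p \<in> fs_preds col n" "p xs"
  then show "length xs = n" by (simp add: fs_preds_def)
next
  fix f :: "pvar \<Rightarrow> 'a list \<Rightarrow> bool" and xs :: "nat list" and e H
  assume f: "assignment (fs_preds col) f" and "distinct xs"
  obtain E where E: "finite E"
    "\<And>g v. g \<in> colour_perms col E \<Longrightarrow> v \<in> freeI H \<Longrightarrow> g (e v) = e v"
    "\<And>g P. g \<in> colour_perms col E \<Longrightarrow> P \<in> freeP H \<Longrightarrow> act g (f P) = f P"
    using sat_supported[OF f] by metis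
  let ?p = "\<lambda>vs. length vs = length xs \<and> sat (fs_preds col) (upd e xs vs) f H"
  have "supports col E ?p"
    unfolding supports_def
  proof (intro ballI allI)
    fix g vs
    assume g: "g \<in> colour_perms col E"
    \<comment> \<open>The parameters of \<open>H\<close> are fixed by \<open>g\<close>, so moving
      all values by \<open>g\<close> affects only the arguments \<open>vs\<close>.\<close>
    have "sat (fs_preds col) (upd e xs (map g vs)) f H \<longleftrightarrow>
        sat (fs_preds col) (g \<circ> upd e xs vs) (\<lambda>P. act g (f P)) H" if "length vs = length xs"
      by (rule sat_cong) (use E g that in \<open>auto intro: upd_equivariant\<close>)
    then show "?p (map g vs) = ?p vs"
      using sat_equivariant[OF colour_perms_mono[OF empty_subsetI g]] by auto
  qed
  then show "?p \<in> fs_preds col (length xs)" using E(1) by (auto simp: fs_preds_def finsupp_def)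
qed

interpretation fs: henkin_asser "fs_preds col" for col
  by (rule fs_preds_henkin_asser)

section \<open>Choice for finitely supported predicates\<close>

text \<open>A witness for one generic individual \<open>b\<close> of a colour is moved to all other generic
  individuals of that colour by transpositions; only finitely many individuals remain.\<close>

lemma choice_one_colour:
  assumes "finite E"
    and equi: "\<And>g a p. g \<in> colour_perms col E \<Longrightarrow> R a p \<Longrightarrow> R (g a) (act g p)"
    and tot: "\<And>a. \<exists>p. finsupp col p \<and> R a p"
  shows "\<exists>F E'. finite E' \<and> (\<forall>a. col a = c \<longrightarrow> R a (F a)) \<and>
    (\<forall>g\<in>colour_perms col E'. \<forall>a. col a = c \<longrightarrow> F (g a) = act g (F a))"
proof -
  obtain w s where w: "\<And>a. R a (w a)" "\<And>a. finite (s a)" "\<And>a. supports col (s a) (w a)"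
    using tot unfolding finsupp_def by metis
  show ?thesis
  proof (cases "\<exists>b. col b = c \<and> b \<notin> E")
    case False
    \<comment> \<open>The whole colour class lies in the finite set \<open>E\<close>, so the
      supports of arbitrarily chosen witnesses can be united.\<close>
    let ?E = "E \<union> (\<Union>a\<in>E. s a)"
    have "w (g a) = act g (w a)" if g: "g \<in> colour_perms col ?E" and "col a = c" for g a
    proof -
      have "a \<in> E" using that False by auto
      then have "g a = a" "g \<in> colour_perms col (s a)"
        using g by (auto simp: colour_perms_def)
      then show ?thesis using supports_act_eq[OF w(3)] by simp
    qed
    moreover have "finite ?E" using \<open>finite E\<close> w by simp
    ultimately show ?thesis using w(1) by (intro exI[of _ w] exI[of _ ?E]) auto
  next
    case True
    then obtain b where b: "col b = c" "b \<notin> E" by blast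
    \<comment> \<open>Leaving out \<open>b\<close> lets transpositions that move \<open>b\<close>
      fix \<open>E1\<close>, which still contains the rest of the support of \<open>w b\<close>. The
      set \<open>E2\<close> also supports the witnesses chosen separately on
      \<open>E1\<close>.\<close>
    define E1 where "E1 = E \<union> s b - {b}"
    define E2 where "E2 = E1 \<union> (\<Union>a\<in>E1. s a)"
    define F where "F = (\<lambda>a. if a \<in> E1 then w a else act (transpose b a) (w b))"
    have fin: "finite E1" "finite E2" using \<open>finite E\<close> w by (auto simp: E1_def E2_def)
    have tr: "transpose b a \<in> colour_perms col E1" if "col a = c" "a \<notin> E1" for a
      using b that by (intro colour_perms_transpose) (auto simp: E1_def)
    have "R a (F a)" if "col a = c" for a
    proof (cases "a \<in> E1")
      case False
      have "transpose b a \<in> colour_perms col E"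
        by (rule colour_perms_mono[OF _ tr]) (use b that False in \<open>auto simp: E1_def\<close>)
      from equi[OF this w(1)[of b]] False show ?thesis by (simp add: F_def)
    qed (simp add: F_def w)
    moreover have "F (g a) = act g (F a)" if g: "g \<in> colour_perms col E2" and a: "col a = c" for g a
    proof (cases "a \<in> E1")
      case True
      then have "g a = a" "g \<in> colour_perms col (s a)"
        using g by (auto simp: colour_perms_def E2_def)
      then show ?thesis using supports_act_eq[OF w(3)] True by (simp add: F_def)
    next
      case False
      have g1: "g \<in> colour_perms col E1" by (rule colour_perms_mono[OF _ g]) (auto simp: E2_def)
      then have bij: "bij g" by (rule colour_perms_bij)
      have ga: "g a \<notin> E1" "col (g a) = c"
      proof
        assume "g a \<in> E1"
        then have "g (g a) = g a" using g1 by (auto simp: colour_perms_def)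
        then have "g a = a" using bij by (simp add: bij_is_inj inj_eq)
        with \<open>g a \<in> E1\<close> False show False by simp
      qed (use g1 a in \<open>simp add: colour_perms_def\<close>)
      txt \<open>The two permutations that move \<open>b\<close> to \<open>g a\<close> agree on the support of \<open>w b\<close>.\<close>
      define h where "h = transpose b (g a) \<circ> (g \<circ> transpose b a)"
      have "h \<in> colour_perms col E1"
        unfolding h_def by (intro colour_perms_comp tr ga g1 a False)
      \<comment> \<open>Under \<open>h\<close>, the individual \<open>b\<close> goes to
        \<open>a\<close>, then to \<open>g a\<close>, and back to \<open>b\<close>.\<close>
      moreover have "h b = b" by (simp add: h_def)
      ultimately have "h \<in> colour_perms col (s b)" by (auto simp: colour_perms_def E1_def)
      then have "act h (w b) = w b" by (rule supports_act_eq[OF w(3)])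
      moreover have "transpose b (g a) \<circ> h = g \<circ> transpose b a"
        unfolding h_def by (simp add: o_assoc)
      ultimately have "act (transpose b (g a)) (w b) = act (g \<circ> transpose b a) (w b)"
        using act_comp[of "transpose b (g a)" h "w b"] colour_perms_bij[OF \<open>h \<in> colour_perms col E1\<close>]
        by simp
      then show ?thesis using False ga bij by (simp add: F_def act_comp)
    qed
    ultimately show ?thesis using fin by blast
  qed
qed

text \<open>Permutations in the group preserve the two colours, so the choice functions of the two
  classes can be glued, and the union of their supports serves both.\<close>

lemma choice_individual:
  assumes "finite E"
    and equi: "\<And>g a p. g \<in> colour_perms col E \<Longrightarrow> R a p \<Longrightarrow> R (g a) (act g p)"
    and tot: "\<And>a. \<exists>p. finsupp col p \<and> R a p"
  shows "\<exists>F E'. finite E' \<and> (\<forall>a. R a (F a)) \<and>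
    (\<forall>g\<in>colour_perms col E'. \<forall>a. F (g a) = act g (F a))"
proof -
  have "\<forall>c. \<exists>F E'. finite E' \<and> (\<forall>a. col a = c \<longrightarrow> R a (F a)) \<and>
    (\<forall>g\<in>colour_perms col E'. \<forall>a. col a = c \<longrightarrow> F (g a) = act g (F a))"
    using choice_one_colour[of E col R] assms by blast
  then obtain F E' where F: "\<And>c. finite (E' c)" "\<And>c a. col a = c \<Longrightarrow> R a (F c a)"
    "\<And>c g a. g \<in> colour_perms col (E' c) \<Longrightarrow> col a = c \<Longrightarrow> F c (g a) = act g (F c a)"
    by metis
  let ?E = "E' True \<union> E' False"
  have "F (col (g a)) (g a) = act g (F (col a) a)" if "g \<in> colour_perms col ?E" for g a
  proof -
    have "g \<in> colour_perms col (E' (col a))"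
      by (rule colour_perms_mono[OF _ that]) (cases "col a"; auto)
    moreover have "col (g a) = col a" using that by (simp add: colour_perms_def)
    ultimately show ?thesis using F(3) by simp
  qed
  then show ?thesis using F(1,2) by (intro exI[of _ "\<lambda>a. F (col a) a"] exI[of _ ?E]) auto
qed

text \<open>Induction on the length, with \<open>E\<close> and \<open>R\<close> arbitrary: for a
  fixed head the induction hypothesis handles the tails, and then \<open>choice_individual\<close>
  chooses uniformly over the heads.\<close>

lemma choice_tuples:
  assumes "finite E"
    and "\<And>g x p. g \<in> colour_perms col E \<Longrightarrow> R x p \<Longrightarrow> R (map g x) (act g p)"
    and "\<And>x. length x = n \<Longrightarrow> \<exists>p. finsupp col p \<and> R x p"
  shows "\<exists>S. finsupp col S \<and> (\<forall>x. length x = n \<longrightarrow> R x (\<lambda>y. S (x @ y)))"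
  using assms
proof (induction n arbitrary: E R)
  case 0
  then show ?case by auto
next
  case (Suc n)
  \<comment> \<open>A single predicate \<open>S\<close> codes the witnesses for all tails that
    follow the head \<open>a\<close>.\<close>
  let ?R = "\<lambda>a S. \<forall>x. length x = n \<longrightarrow> R (a # x) (\<lambda>y. S (x @ y))"
  have "\<exists>F E'. finite E' \<and> (\<forall>a. ?R a (F a)) \<and>
      (\<forall>g\<in>colour_perms col E'. \<forall>a. F (g a) = act g (F a))"
  proof (rule choice_individual[OF Suc.prems(1)])
    fix g a S
    assume g: "g \<in> colour_perms col E" and R: "?R a S"
    show "?R (g a) (act g S)"
    proof (intro allI impI)
      fix x :: "'a list"
      assume "length x = n"
      \<comment> \<open>The tail is pulled back along \<open>g\<close>, so that applying
        \<open>g\<close> again returns \<open>x\<close>.\<close>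
      then have "R (a # map (inv g) x) (\<lambda>y. S (map (inv g) x @ y))" using R by simp
      from Suc.prems(2)[OF g this]
      show "R (g a # x) (\<lambda>y. act g S (x @ y))"
        using colour_perms_bij[OF g] by (simp add: act_def comp_def bij_is_surj surj_f_inv_f)
    qed
  next
    fix a
    show "\<exists>S. finsupp col S \<and> ?R a S"
    \<comment> \<open>A fixed head acts as a parameter and therefore joins the individuals to be
      fixed.\<close>
    proof (rule Suc.IH[of "insert a E"])
      fix g x p
      assume g: "g \<in> colour_perms col (insert a E)" "R (a # x) p"
      have "g \<in> colour_perms col E" "g a = a" using g by (auto simp: colour_perms_def)
      then show "R (a # map g x) (act g p)" using Suc.prems(2)[of g "a # x" p] g by simp
    qed (use Suc.prems in auto)
  qed
  then obtain F E' where F: "finite E'" "\<And>a. ?R a (F a)"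
    "\<And>g a. g \<in> colour_perms col E' \<Longrightarrow> F (g a) = act g (F a)"
    by blast
  \<comment> \<open>The choices for the separate heads become sections of one predicate;
    equivariance of \<open>F\<close> turns into invariance of \<open>S\<close>.\<close>
  define S where "S = (\<lambda>z. z \<noteq> [] \<and> F (hd z) (tl z))"
  have "supports col E' S"
    unfolding supports_def
  proof (intro ballI allI)
    fix g xs
    assume g: "g \<in> colour_perms col E'"
    show "S (map g xs) = S xs"
      using F(3)[OF g] act_map[OF colour_perms_bij[OF g]] by (cases xs) (auto simp: S_def)
  qed
  moreover have "R x (\<lambda>y. S (x @ y))" if "length x = Suc n" for x
    using that F(2) by (auto simp: length_Suc_conv S_def)
  ultimately show ?case using F(1) by (auto simp: finsupp_def)
qed

section \<open>Validity of the Hilbert-Ackermann choice axioms\<close>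

lemma choice_h_valid:
  assumes K: "K \<in> choice_h n m" and "1 \<le> n" "1 \<le> m"
  shows "valid (fs_preds col) K"
  unfolding valid_def
proof (intro allI impI)
  let ?J = "fs_preds col"
  fix e f
  assume f: "assignment ?J f"
  from K obtain x y D S H where K_def:
    "K = Imp (AllIs x (ExP D H))
         (ExP S (AllIs x (ExP D (Conj (AllIs y (Iff (Atom D y) (Atom S (x @ y)))) H))))"
    and len: "length x = n" "length y = m" and dist: "distinct (x @ y)"
    and ar: "arity D = m" "arity S = n + m" and S: "S \<notin> occP H"
    unfolding choice_h_def by blast
  \<comment> \<open>Membership in \<open>?J m\<close> is part of \<open>R\<close>, so that the
    sections obtained later are admissible values of \<open>D\<close>.\<close>
  define R where "R = (\<lambda>vs p. length vs = n \<and> p \<in> ?J m \<and> sat ?J (upd e x vs) (f(D := p)) H)"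
  obtain E where E: "finite E"
    "\<And>g v. g \<in> colour_perms col E \<Longrightarrow> v \<in> freeI H \<Longrightarrow> g (e v) = e v"
    "\<And>g P. g \<in> colour_perms col E \<Longrightarrow> P \<in> freeP H \<Longrightarrow> act g (f P) = f P"
    using sat_supported[OF f] by metis
  show "sat ?J e f K"
    unfolding K_def sat.simps(5)
  proof
    assume "sat ?J e f (AllIs x (ExP D H))"
    then have tot: "\<exists>p. finsupp col p \<and> R vs p" if "length vs = n" for vs
      using that len ar by (auto simp: sat_AllIs R_def fs_preds_def)
    have "\<exists>s. finsupp col s \<and> (\<forall>vs. length vs = n \<longrightarrow> R vs (\<lambda>ws. s (vs @ ws)))"
    proof (rule choice_tuples[OF E(1) _ tot])
      fix g vs p
      assume g: "g \<in> colour_perms col E" and R: "R vs p"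
      have g0: "g \<in> colour_perms col {}" using colour_perms_mono[OF empty_subsetI g] .
      have "sat ?J (upd e x (map g vs)) (f(D := act g p)) H \<longleftrightarrow>
          sat ?J (g \<circ> upd e x vs) (\<lambda>P. act g ((f(D := p)) P)) H"
        by (rule sat_cong) (use E g R len in \<open>auto simp: R_def intro: upd_equivariant\<close>)
      also have "\<dots> \<longleftrightarrow> sat ?J (upd e x vs) (f(D := p)) H" by (rule sat_equivariant[OF g0])
      finally show "R (map g vs) (act g p)"
        using R fs_preds_act[OF g0, of p m] by (simp add: R_def)
    qed
    then obtain s where s: "finsupp col s" "\<And>vs. length vs = n \<Longrightarrow> R vs (\<lambda>ws. s (vs @ ws))"
      by blast
    \<comment> \<open>The predicate \<open>s\<close> is cut down to arity \<open>n + m\<close>;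
      supports survive because \<open>map\<close> preserves length.\<close>
    define t where "t = (\<lambda>z. length z = n + m \<and> s z)"
    have t: "t \<in> ?J (arity S)"
      using s(1) ar by (auto simp: t_def fs_preds_def finsupp_def supports_def)
    \<comment> \<open>The arities \<open>n + m\<close> and \<open>m\<close> differ, so the updates
      at \<open>S\<close> and \<open>D\<close> do not interfere.\<close>
    have "S \<noteq> D" using ar \<open>1 \<le> n\<close> by auto
    have "\<exists>p\<in>?J (arity D). sat ?J (upd e x vs) (f(S := t, D := p))
        (Conj (AllIs y (Iff (Atom D y) (Atom S (x @ y)))) H)" if vs: "length vs = n" for vs
    proof
      let ?p = "\<lambda>ws. s (vs @ ws)"
      show "?p \<in> ?J (arity D)" using s(2)[OF vs] ar by (simp add: R_def)
      have "sat ?J (upd e x vs) (f(S := t, D := ?p)) H \<longleftrightarrow> sat ?J (upd e x vs) (f(D := ?p)) H"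
        by (rule sat_cong) (use S freeP_subset_occP[of H] in auto)
      then have "sat ?J (upd e x vs) (f(S := t, D := ?p)) H"
        using s(2)[OF vs] by (simp add: R_def)
      then show "sat ?J (upd e x vs) (f(S := t, D := ?p))
        (Conj (AllIs y (Iff (Atom D y) (Atom S (x @ y)))) H)"
        using \<open>S \<noteq> D\<close> vs len dist by (auto simp: sat_AllIs t_def)
    qed
    then show "sat ?J e f (ExP S (AllIs x (ExP D
        (Conj (AllIs y (Iff (Atom D y) (Atom S (x @ y)))) H))))"
      using t len by (auto simp: sat_AllIs simp del: fun_upd_apply)
  qed
qed

lemma choice_h2_valid: "K \<in> choice_h2 \<Longrightarrow> valid (fs_preds col) K"
  unfolding choice_h2_def using choice_h_valid by auto

section \<open>Trichotomy and linear ordering\<close>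

lemma sat_inj_map_fm:
  "sat J e f (inj_map_fm n F A B) \<longleftrightarrow>
    (\<forall>v w. length v = n \<longrightarrow> length w = n \<longrightarrow> f F (v @ w) \<longrightarrow> f A v \<and> f B w) \<and>
    (\<forall>v. length v = n \<longrightarrow> f A v \<longrightarrow> (\<exists>w. length w = n \<and> f F (v @ w))) \<and>
    (\<forall>u v w. length u = n \<longrightarrow> length v = n \<longrightarrow> length w = n \<longrightarrow>
      f F (u @ v) \<and> f F (u @ w) \<longrightarrow> v = w) \<and>
    (\<forall>u v w. length u = n \<longrightarrow> length v = n \<longrightarrow> length w = n \<longrightarrow>
      f F (u @ w) \<and> f F (v @ w) \<longrightarrow> u = v)"
proof -
  \<comment> \<open>Naming the blocks hides their intervals: only lengths, distinctness and
    disjointness are used below.\<close>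
  obtain x y z where xyz: "x = [0..<n]" "y = [n..<2*n]" "z = [2*n..<3*n]" by blast
  have len: "length x = n" "length y = n" "length z = n" by (simp_all add: xyz)
  have dist: "distinct x" "distinct y" "distinct z" "set x \<inter> set y = {}" "set y \<inter> set z = {}"
    "set x \<inter> set z = {}" by (auto simp: xyz)
  show ?thesis
    unfolding inj_map_fm_def Let_def xyz[symmetric]
    by (simp only: AllIs_append sat_AllIs sat_ExIs sat_EqIs sat_Conj sat.simps(3,5) len dist
        map_append map_upd_same map_upd_disjoint all_simps simp_thms cong: conj_cong imp_cong)
qed

lemma sat_lin_ord_fm:
  "sat J e f (lin_ord_fm n T A) \<longleftrightarrow>
    (\<forall>v w. length v = n \<longrightarrow> length w = n \<longrightarrow> f T (v @ w) \<longrightarrow> f A v \<and> f A w) \<and>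
    (\<forall>v. length v = n \<longrightarrow> f A v \<longrightarrow> f T (v @ v)) \<and>
    (\<forall>v w. length v = n \<longrightarrow> length w = n \<longrightarrow> f T (v @ w) \<and> f T (w @ v) \<longrightarrow> v = w) \<and>
    (\<forall>u v w. length u = n \<longrightarrow> length v = n \<longrightarrow> length w = n \<longrightarrow>
      f T (u @ v) \<and> f T (v @ w) \<longrightarrow> f T (u @ w)) \<and>
    (\<forall>v w. length v = n \<longrightarrow> length w = n \<longrightarrow> f A v \<and> f A w \<longrightarrow> \<not> f T (v @ w) \<longrightarrow> f T (w @ v))"
proof -
  obtain x y z where xyz: "x = [0..<n]" "y = [n..<2*n]" "z = [2*n..<3*n]" by blast
  have len: "length x = n" "length y = n" "length z = n" by (simp_all add: xyz)
  have dist: "distinct x" "distinct y" "distinct z" "set x \<inter> set y = {}" "set y \<inter> set z = {}"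
    "set x \<inter> set z = {}" by (auto simp: xyz)
  show ?thesis
    unfolding lin_ord_fm_def Let_def xyz[symmetric]
    by (simp only: AllIs_append sat_AllIs sat_EqIs sat_Conj sat_Neg_Atom sat.simps(3,5) len dist
        map_append map_upd_same map_upd_disjoint all_simps simp_thms cong: imp_cong)
qed

lemma sat_TR:
  assumes "1 \<le> n"
  shows "sat J e f (TR n) \<longleftrightarrow> (\<forall>a\<in>J n. \<forall>b\<in>J n. \<exists>p\<in>J (2 * n).
    sat J e (f(PV n 0 := a, PV n 1 := b, PV (2 * n) 0 := p)) (inj_map_fm n (PV (2 * n) 0) (PV n 0) (PV n 1)) \<or>
    sat J e (f(PV n 0 := a, PV n 1 := b, PV (2 * n) 0 := p)) (inj_map_fm n (PV (2 * n) 0) (PV n 1) (PV n 0)))"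
  by (simp add: TR_def Let_def bex_disj_distrib imp_conv_disj)

lemma sat_LO:
  "sat J e f (LO n) \<longleftrightarrow> (\<forall>a\<in>J n. \<exists>p\<in>J (2 * n).
    sat J e (f(PV n 0 := a, PV (2 * n) 0 := p)) (lin_ord_fm n (PV (2 * n) 0) (PV n 0)))"
  by (auto simp: LO_def Let_def)

section \<open>The structure with one individual, where both principles hold\<close>

lemma fs_preds_finite_type:
  "p \<in> fs_preds col n \<longleftrightarrow> (\<forall>xs. p xs \<longrightarrow> length xs = n)" for p :: "'a::finite list \<Rightarrow> bool"
proof -
  \<comment> \<open>With all individuals as support, only the identity remains in the
    stabilizer.\<close>
  have "g = id" if "g \<in> colour_perms col UNIV" for g :: "'a \<Rightarrow> 'a"
    using that by (auto simp: colour_perms_def)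
  then have "supports col UNIV p" unfolding supports_def by (metis list.map_id)
  then show ?thesis using finite by (auto simp: fs_preds_def finsupp_def)
qed

lemma unit_list_eq_iff: "v = w \<longleftrightarrow> length v = length w" for v w :: "unit list"
  by (auto simp: list_eq_iff_nth_eq)

lemma unit_pred_const:
  fixes p :: "unit list \<Rightarrow> bool"
  obtains \<alpha> where "\<And>v. length v = n \<Longrightarrow> p v = \<alpha>"
proof (rule that)
  fix v :: "unit list"
  assume "length v = n"
  then have "v = replicate n ()" by (simp add: unit_list_eq_iff)
  then show "p v = p (replicate n ())" by simp
qed

text \<open>There is only one \<open>n\<close>-tuple, so the full relation is an injection between
  full predicates, and the empty relation is one out of the empty predicate.\<close>

lemma inj_map_unit:
  fixes e :: "nat \<Rightarrow> unit"
  assumes F: "\<And>z. f F z \<longleftrightarrow> length z = 2 * n \<and> \<alpha>" and A: "\<And>v. length v = n \<Longrightarrow> f A v = \<alpha>"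
    and B: "\<And>v. \<alpha> \<Longrightarrow> length v = n \<Longrightarrow> f B v"
  shows "sat J e f (inj_map_fm n F A B)"
proof -
  have "\<exists>w :: unit list. length w = n" by (rule exI[of _ "replicate n ()"]) simp
  then show ?thesis
    unfolding sat_inj_map_fm unit_list_eq_iff F using A B by auto
qed

lemma TR_unit:
  assumes "1 \<le> n"
  shows "sat (fs_preds col) (e :: nat \<Rightarrow> unit) f (TR n)"
  unfolding sat_TR[OF assms]
proof (intro ballI)
  fix a b :: "unit list \<Rightarrow> bool"
  obtain \<alpha> where a: "\<And>v. length v = n \<Longrightarrow> a v = \<alpha>" using unit_pred_const[of n a] by blast
  obtain \<beta> where b: "\<And>v. length v = n \<Longrightarrow> b v = \<beta>" using unit_pred_const[of n b] by blast
  \<comment> \<open>One relation serves both directions: it reduces to \<open>\<alpha>\<close> if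
    \<open>\<alpha>\<close> implies \<open>\<beta>\<close>, and otherwise to \<open>\<beta>\<close>,
    which is then false.\<close>
  let ?p = "\<lambda>z. length z = 2 * n \<and> \<alpha> \<and> \<beta>"
  let ?f = "f(PV n 0 := a, PV n 1 := b, PV (2 * n) 0 := ?p)"
  have f: "?f (PV (2 * n) 0) = ?p" "?f (PV n 0) = a" "?f (PV n 1) = b" using assms by auto
  have "sat (fs_preds col) e ?f (inj_map_fm n (PV (2 * n) 0) (PV n 0) (PV n 1)) \<or>
    sat (fs_preds col) e ?f (inj_map_fm n (PV (2 * n) 0) (PV n 1) (PV n 0))"
  proof (cases "\<alpha> \<longrightarrow> \<beta>")
    case True
    then have "sat (fs_preds col) e ?f (inj_map_fm n (PV (2 * n) 0) (PV n 0) (PV n 1))"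
      by (intro inj_map_unit[where \<alpha> = \<alpha>]; unfold f) (use a b in auto)
    then show ?thesis ..
  next
    case False
    then have "sat (fs_preds col) e ?f (inj_map_fm n (PV (2 * n) 0) (PV n 1) (PV n 0))"
      by (intro inj_map_unit[where \<alpha> = \<beta>]; unfold f) (use a b in auto)
    then show ?thesis ..
  qed
  moreover have "?p \<in> fs_preds col (2 * n)" by (simp add: fs_preds_finite_type)
  ultimately show "\<exists>p\<in>fs_preds col (2 * n).
    sat (fs_preds col) e (f(PV n 0 := a, PV n 1 := b, PV (2 * n) 0 := p)) (inj_map_fm n (PV (2 * n) 0) (PV n 0) (PV n 1)) \<or>
    sat (fs_preds col) e (f(PV n 0 := a, PV n 1 := b, PV (2 * n) 0 := p)) (inj_map_fm n (PV (2 * n) 0) (PV n 1) (PV n 0))"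
    by blast
qed

lemma LO_unit:
  assumes "1 \<le> n"
  shows "sat (fs_preds col) (e :: nat \<Rightarrow> unit) f (LO n)"
  unfolding sat_LO
proof
  fix a :: "unit list \<Rightarrow> bool"
  obtain \<alpha> where a: "\<And>v. length v = n \<Longrightarrow> a v = \<alpha>" using unit_pred_const[of n a] by blast
  \<comment> \<open>The full relation orders the only tuple if \<open>a\<close> holds of it;
    otherwise the ordering is empty.\<close>
  let ?p = "\<lambda>z. length z = 2 * n \<and> \<alpha>"
  let ?f = "f(PV n 0 := a, PV (2 * n) 0 := ?p)"
  have f: "?f (PV (2 * n) 0) = ?p" "?f (PV n 0) = a" using assms by auto
  have "sat (fs_preds col) e ?f (lin_ord_fm n (PV (2 * n) 0) (PV n 0))"
    unfolding sat_lin_ord_fm f unit_list_eq_iff using a by auto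
  moreover have "?p \<in> fs_preds col (2 * n)" by (simp add: fs_preds_finite_type)
  ultimately show "\<exists>p\<in>fs_preds col (2 * n).
    sat (fs_preds col) e (f(PV n 0 := a, PV (2 * n) 0 := p)) (lin_ord_fm n (PV (2 * n) 0) (PV n 0))"
    by blast
qed

section \<open>Two infinite colour classes, where both principles fail\<close>

lemma two_fresh:
  assumes "finite (E :: (bool \<times> nat) set)"
  obtains u u' where "u \<noteq> u'" "fst u = c" "fst u' = c" "u \<notin> E" "u' \<notin> E"
proof -
  have "infinite (Pair c ` (UNIV :: nat set))" by (simp add: finite_image_iff inj_on_def)
  then have inf: "infinite (Pair c ` (UNIV :: nat set) - E)" using assms by simp
  then obtain u where u: "u \<in> Pair c ` UNIV - E" using infinite_imp_nonempty by blast
  obtain u' where "u' \<in> Pair c ` UNIV - E - {u}"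
    using infinite_imp_nonempty[OF infinite_remove[OF inf, of u]] by blast
  with u show thesis by (intro that[of u u']) auto
qed

text \<open>Transposing two individuals outside the support of \<open>F\<close> fixes every tuple of the other
  colour, so \<open>F\<close> identifies them.\<close>

lemma no_injection_between_colours:
  fixes e :: "nat \<Rightarrow> bool \<times> nat"
  assumes n: "1 \<le> n" and F: "finsupp fst (f F)"
    and A: "f A = (\<lambda>xs. length xs = n \<and> (\<forall>x\<in>set xs. fst x = c))"
    and B: "f B = (\<lambda>xs. length xs = n \<and> (\<forall>x\<in>set xs. fst x = (\<not> c)))"
  shows "\<not> sat J e f (inj_map_fm n F A B)"
proof
  assume S: "sat J e f (inj_map_fm n F A B)"
  obtain E where E: "finite E" "supports fst E (f F)" using F unfolding finsupp_def by blast
  obtain u u' where u: "u \<noteq> u'" "fst u = c" "fst u' = c" "u \<notin> E" "u' \<notin> E"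
    using two_fresh[OF E(1)] by metis
  \<comment> \<open>Transposing \<open>u\<close> and \<open>u'\<close> exchanges these constant
    tuples, which differ because \<open>1 \<le> n\<close>.\<close>
  let ?r = "replicate n u" and ?r' = "replicate n u'"
  have "f A ?r" using u by (simp add: A)
  then obtain w where w: "length w = n" "f F (?r @ w)"
    using S unfolding sat_inj_map_fm by (metis length_replicate)
  then have "f B w" using S unfolding sat_inj_map_fm by (metis length_replicate)
  then have "map (transpose u u') w = w"
    using u by (intro map_idI) (auto simp: B transpose_def)
  moreover have "f F (map (transpose u u') (?r @ w)) = f F (?r @ w)"
    by (rule supportsD[OF E(2)]) (use u in \<open>auto intro: colour_perms_transpose\<close>)
  ultimately have "f F (?r' @ w)" using w by simp
  with w S have "?r = ?r'" unfolding sat_inj_map_fm by (metis length_replicate)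
  then show False using n u by (simp add: replicate_eq_replicate)
qed

lemma not_TR:
  assumes n: "1 \<le> n"
  shows "\<not> sat (fs_preds fst) (e :: nat \<Rightarrow> bool \<times> nat) f (TR n)"
proof
  let ?U = "\<lambda>c xs. length xs = n \<and> (\<forall>x\<in>set xs. fst x = c)"
  assume S: "sat (fs_preds fst) e f (TR n)"
  \<comment> \<open>Colours are preserved by the whole group, so the empty set supports each
    monochromatic predicate.\<close>
  have "supports fst {} (?U c)" for c by (auto simp: supports_def colour_perms_def)
  then have U: "?U c \<in> fs_preds fst n" for c
    unfolding fs_preds_def finsupp_def by blast
  let ?f = "\<lambda>p. f(PV n 0 := ?U True, PV n 1 := ?U False, PV (2 * n) 0 := p)"
  from S U[of True] U[of False] obtain p where p: "p \<in> fs_preds fst (2 * n)"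
    and inj: "sat (fs_preds fst) e (?f p) (inj_map_fm n (PV (2 * n) 0) (PV n 0) (PV n 1)) \<or>
      sat (fs_preds fst) e (?f p) (inj_map_fm n (PV (2 * n) 0) (PV n 1) (PV n 0))"
    unfolding sat_TR[OF n] by blast
  have val: "?f p (PV (2 * n) 0) = p" "?f p (PV n 0) = ?U True" "?f p (PV n 1) = ?U False"
    using n by auto
  have "finsupp fst (?f p (PV (2 * n) 0))" using p by (simp add: fs_preds_def)
  \<comment> \<open>The colour of the source stays open here: it is \<open>True\<close> for the
    first disjunct and \<open>False\<close> for the second.\<close>
  note no_inj = no_injection_between_colours[where f = "?f p" and F = "PV (2 * n) 0", OF n this]
  from inj show False
  proof
    assume "sat (fs_preds fst) e (?f p) (inj_map_fm n (PV (2 * n) 0) (PV n 0) (PV n 1))"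
    moreover have "?f p (PV n 1) = ?U (\<not> True)" using val(3) by simp
    ultimately show False using no_inj[OF val(2)] by blast
  next
    assume "sat (fs_preds fst) e (?f p) (inj_map_fm n (PV (2 * n) 0) (PV n 1) (PV n 0))"
    moreover have "?f p (PV n 0) = ?U (\<not> False)" using val(2) by simp
    ultimately show False using no_inj[OF val(3)] by blast
  qed
qed

text \<open>Already the set of all \<open>n\<close>-tuples has no ordering: totality relates two
  swapped constant tuples one way, invariance gives the other way as well, and antisymmetry then
  identifies them.\<close>

lemma not_LO:
  assumes n: "1 \<le> n"
  shows "\<not> sat (fs_preds fst) (e :: nat \<Rightarrow> bool \<times> nat) f (LO n)"
proof
  assume S: "sat (fs_preds fst) e f (LO n)"
  let ?A = "\<lambda>xs. length xs = n"
  let ?f = "\<lambda>p. f(PV n 0 := ?A, PV (2 * n) 0 := p)"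
  have "?A \<in> fs_preds fst n" by (auto simp: fs_preds_def finsupp_def supports_def)
  then obtain p where p: "p \<in> fs_preds fst (2 * n)"
    and lin: "sat (fs_preds fst) e (?f p) (lin_ord_fm n (PV (2 * n) 0) (PV n 0))"
    using S unfolding sat_LO by blast
  have val: "?f p (PV (2 * n) 0) = p" "?f p (PV n 0) = ?A" using n by auto
  have anti: "\<And>v w. length v = n \<Longrightarrow> length w = n \<Longrightarrow> p (v @ w) \<Longrightarrow> p (w @ v) \<Longrightarrow> v = w"
    and total: "\<And>v w. length v = n \<Longrightarrow> length w = n \<Longrightarrow> p (v @ w) \<or> p (w @ v)"
    using lin unfolding sat_lin_ord_fm val by blast+
  obtain E where E: "finite E" "supports fst E p"
    using p by (auto simp: fs_preds_def finsupp_def)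
  obtain u u' where u: "u \<noteq> u'" "fst u = True" "fst u' = True" "u \<notin> E" "u' \<notin> E"
    using two_fresh[OF E(1)] by metis
  let ?r = "replicate n u" and ?r' = "replicate n u'"
  have "p (map (transpose u u') (?r @ ?r')) = p (?r @ ?r')"
    by (rule supportsD[OF E(2)]) (use u in \<open>auto intro: colour_perms_transpose\<close>)
  then have "p (?r' @ ?r) = p (?r @ ?r')" by simp
  then have "?r = ?r'" using anti[of ?r ?r'] total[of ?r ?r'] by simp
  then show False using n u by (simp add: replicate_eq_replicate)
qed

theorem theorem5p3:
  assumes "consistent ZFC"
  shows "\<forall>n\<ge>1. \<forall>\<phi>\<in>{TR n, LO n}. HPL_independent \<phi> choice_h2"
proof (intro allI impI ballI)
  fix n :: nat and \<phi>
  assume n: "1 \<le> n" and "\<phi> \<in> {TR n, LO n}"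
  \<comment> \<open>Colouring \<open>bool \<times> nat\<close> by \<open>fst\<close> gives two
    infinite classes, and \<open>unit\<close> gives the single individual. Both structures satisfy
    the choice axioms, so soundness excludes a derivation of the sentence by the first and of its
    negation by the second.\<close>
  then have "\<not> sat (fs_preds fst) e f \<phi>" "sat (fs_preds (\<lambda>_. True)) e' f' \<phi>"
    for e :: "nat \<Rightarrow> bool \<times> nat" and f and e' :: "nat \<Rightarrow> unit" and f'
    using not_TR not_LO TR_unit LO_unit by auto
  then show "HPL_independent \<phi> choice_h2"
    unfolding HPL_independent_def
    using fs.not_derivable[where col = fst and G = choice_h2 and H = \<phi>, OF choice_h2_valid]
      fs.not_derivable[where col = "\<lambda>_::unit. True" and G = choice_h2 and H = "Neg \<phi>",
        OF choice_h2_valid]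
    by auto
qed

end
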